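(* For any graph $G$ and any graph $H$ with root $v\in V(H)$, $$\chi_i(G\circ_v H)\in\{\chi_i(G),\ \chi_i(H),\ \chi_i(G)+1,\ \chi_i(H)+1,\ \Delta(G)+d_H(v),\ \Delta(G)+d_H(v)+1\}.$$
   Context: An injective $k$-coloring of a graph is a map $f:V\to\{1,\dots,k\}$ such that no vertex has two neighbors $u\neq w$ with $f(u)=f(w)$; $\chi_i$ denotes the least such $k$. For a graph $G$ with $V(G)=\{v_1,\ldots,v_n\}$ and a graph $H$ with root $v$, the rooted product $G\circ_v H$ has vertex set $V(G)\times V(H)$ and edge set $\bigcup_{i=1}^n\{(v_i,h)(v_i,h') : hh'\in E(H)\}\cup\{(v_i,v)(v_j,v): v_iv_j\in E(G)\}$ (i.e., a copy of $H$ is attached to each vertex $v_i$ of $G$ by identifying its root with $v_i$). $\Delta(G)$ is the maximum degree of $G$ and $d_H(v)$ the degree of $v$ in $H$. *)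

theory Defs
  imports "Graph_Theory.Pair_Digraph"
begin

(* A finite simple undirected graph is a pair_graph: a finite loop-free symmetric pair digraph,
   each edge uw being represented by the two arcs (u,w) and (w,u). Hence the out-degree of a
   vertex is its degree. The null graph is a pair_graph. *)

abbreviation degree :: "'a pair_pre_digraph \<Rightarrow> 'a \<Rightarrow> nat" where
  "degree G u \<equiv> out_degree (with_proj G) u"

(* On nat, the supremum of a finite nonempty set is its maximum, and Sup {} = 0. *)
definition max_degree :: "'a pair_pre_digraph \<Rightarrow> nat" where
  "max_degree G = (SUP u\<in>pverts G. degree G u)"

definition injective_coloring :: "'a pair_pre_digraph \<Rightarrow> nat \<Rightarrow> ('a \<Rightarrow> nat) \<Rightarrow> bool" where
  "injective_coloring G k f \<longleftrightarrow>
     f ` pverts G \<subseteq> {1..k} \<and>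
     (\<forall>x\<in>pverts G. \<forall>u w. (x, u) \<in> parcs G \<and> (x, w) \<in> parcs G \<and> u \<noteq> w \<longrightarrow> f u \<noteq> f w)"

definition injective_chromatic_number :: "'a pair_pre_digraph \<Rightarrow> nat" where
  "injective_chromatic_number G = (LEAST k. \<exists>f. injective_coloring G k f)"

definition rooted_product ::
  "'a pair_pre_digraph \<Rightarrow> 'b pair_pre_digraph \<Rightarrow> 'b \<Rightarrow> ('a \<times> 'b) pair_pre_digraph" where
  "rooted_product G H v =
     \<lparr> pverts = pverts G \<times> pverts H,
       parcs = {((g, h), (g, h')) | g h h'. g \<in> pverts G \<and> (h, h') \<in> parcs H} \<union>
               {((g, v), (g', v)) | g g'. (g, g') \<in> parcs G} \<rparr>"

lemma injective_coloring_exists: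
  assumes "pair_graph G"
  shows "\<exists>k f. injective_coloring G k f"
proof -
  interpret pair_graph G by fact
  obtain f :: "'a \<Rightarrow> nat" where f: "bij_betw f (pverts G) {1..card (pverts G)}"
    using ex_bij_betw_finite_nat[OF pair_finite_verts]
      finite_same_card_bij[OF pair_finite_verts, of "{1..card (pverts G)}"] by auto
  have "injective_coloring G (card (pverts G)) f"
    using f unfolding injective_coloring_def bij_betw_def
    by (auto dest: in_arcsD2 inj_onD)
  then show ?thesis by blast
qed

lemma pair_graph_rooted_product:
  assumes "pair_graph G" and "pair_graph H" and "v \<in> pverts H"
  shows "pair_graph (rooted_product G H v)"
proof -
  interpret G: pair_graph G by fact
  interpret H: pair_graph H by fact
  let ?P = "rooted_product G H v"
  have fin: "finite (pverts ?P)"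
    by (simp add: rooted_product_def G.pair_finite_verts H.pair_finite_verts)
  have sub: "parcs ?P \<subseteq> pverts ?P \<times> pverts ?P"
    using assms(3) by (auto simp: rooted_product_def dest: G.in_arcsD1 G.in_arcsD2 H.in_arcsD1 H.in_arcsD2)
  have fina: "finite (parcs ?P)"
    by (rule finite_subset[OF sub]) (simp add: fin)
  have sym: "sym (parcs ?P)"
    by (rule symI) (auto simp: rooted_product_def dest: G.arcs_symmetric H.arcs_symmetric)
  have irrefl: "fst e \<noteq> snd e" if "e \<in> parcs ?P" for e
    using that by (auto simp: rooted_product_def dest: G.no_loops' H.no_loops')
  show ?thesis
    by unfold_locales (use fin fina sub sym irrefl in \<open>auto simp: symmetric_def\<close>)
qed

end

theory Submission
  imports Defs
begin

text \<open>
  Let \<open>M\<close> be the maximum of \<open>\<chi>\<^sub>i(G)\<close>, \<open>\<chi>\<^sub>i(H)\<close> and \<open>\<Delta>(G) + d\<^sub>H(v)\<close>; then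
  \<open>\<chi>\<^sub>i(G \<circ>\<^sub>v H)\<close> is \<open>M\<close> or \<open>M + 1\<close>. The lower bound holds because \<open>G\<close> and \<open>H\<close> are subgraphs and
  the neighbours of a single vertex need distinct colors. For the upper bound, color \<open>G\<close> with \<open>M\<close>
  colors by \<open>c\<close>, color \<open>H\<close> with \<open>M\<close> colors, and recolor the root \<open>v\<close> with the new color \<open>M + 1\<close>.
  In the copy of \<open>H\<close> at \<open>g\<close> permute the \<open>M + 1\<close> colors so that \<open>v\<close> receives \<open>c(g)\<close> and the
  neighbours of \<open>v\<close> avoid \<open>c(g)\<close> and the colors of the neighbours of \<open>g\<close>: there remain at least
  \<open>M - d\<^sub>G(g) \<ge> d\<^sub>H(v)\<close> colors for them.
\<close>

section \<open>Degrees as cardinalities of neighbourhoods\<close>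

lemma degree_eq_card: "degree G u = card {w. (u, w) \<in> parcs G}"
proof -
  have "out_arcs (with_proj G) u = Pair u ` {w. (u, w) \<in> parcs G}"
    by (auto simp: out_arcs_def)
  then show ?thesis
    by (simp add: out_degree_def card_image inj_on_def)
qed

lemma (in pair_graph) finite_neighbours: "finite {w. (u, w) \<in> parcs G}"
  by (rule finite_subset[OF _ pair_finite_verts]) (auto dest: in_arcsD2)

lemma (in pair_graph) degree_le_max_degree:
  assumes "u \<in> pverts G"
  shows "degree G u \<le> max_degree G"
  unfolding max_degree_def
  by (rule cSUP_upper[OF assms]) (simp add: pair_finite_verts)

lemma (in pair_graph) max_degree_attained:
  assumes "pverts G \<noteq> {}"
  obtains u where "u \<in> pverts G" and "max_degree G = degree G u"
proof -
  have "max_degree G = Max (degree G ` pverts G)"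
    unfolding max_degree_def using assms pair_finite_verts by (simp add: cSup_eq_Max)
  moreover have "Max (degree G ` pverts G) \<in> degree G ` pverts G"
    using assms pair_finite_verts by (intro Max_in) auto
  ultimately show thesis using that by auto
qed

section \<open>Injective colorings and the injective chromatic number\<close>

lemma injective_coloringD:
  assumes "injective_coloring G k f" and "x \<in> pverts G"
    and "(x, u) \<in> parcs G" and "(x, w) \<in> parcs G" and "f u = f w"
  shows "u = w"
  using assms unfolding injective_coloring_def by blast

lemma injective_coloring_mono:
  assumes "injective_coloring G k f" and "k \<le> l"
  shows "injective_coloring G l f"
  using assms unfolding injective_coloring_def by force

lemma injective_chromatic_number_le:
  assumes "injective_coloring G k f"
  shows "injective_chromatic_number G \<le> k"
  unfolding injective_chromatic_number_def using assms by (blast intro: Least_le)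

lemma injective_coloring_if_chromatic_number_le:
  assumes "pair_graph G" and "injective_chromatic_number G \<le> k"
  obtains f where "injective_coloring G k f"
proof -
  have "\<exists>f. injective_coloring G (injective_chromatic_number G) f"
    unfolding injective_chromatic_number_def
    using injective_coloring_exists[OF assms(1)] by (rule LeastI_ex)
  then show thesis using injective_coloring_mono[OF _ assms(2)] that by blast
qed

lemma degree_le_injective_coloring:
  assumes "pair_graph G" and "injective_coloring G k f" and "u \<in> pverts G"
  shows "degree G u \<le> k"
proof -
  interpret pair_graph G by fact
  have "inj_on f {w. (u, w) \<in> parcs G}"
    using injective_coloringD[OF assms(2,3)] by (auto intro: inj_onI)
  moreover have "f ` {w. (u, w) \<in> parcs G} \<subseteq> {1..k}"
    using assms(2) unfolding injective_coloring_def by (auto dest: in_arcsD2)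
  ultimately have "card {w. (u, w) \<in> parcs G} \<le> card {1..k}"
    by (intro card_inj_on_le) auto
  then show ?thesis by (simp add: degree_eq_card)
qed

section \<open>Renaming the colors of a coloring\<close>

lemma injective_coloring_comp:
  assumes "pair_graph G" and "injective_coloring G k f"
    and "inj_on p {1..k}" and "p ` {1..k} \<subseteq> {1..l}"
  shows "injective_coloring G l (p \<circ> f)"
proof -
  interpret pair_graph G by fact
  show ?thesis
    unfolding injective_coloring_def
  proof (intro conjI ballI allI impI)
    show "(p \<circ> f) ` pverts G \<subseteq> {1..l}"
      using assms(2,4) unfolding injective_coloring_def by (auto simp: image_subset_iff)
    fix x u w
    assume x: "x \<in> pverts G" and uw: "(x, u) \<in> parcs G \<and> (x, w) \<in> parcs G \<and> u \<noteq> w"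
    then have "f u \<in> {1..k}" "f w \<in> {1..k}" "f u \<noteq> f w"
      using assms(2) unfolding injective_coloring_def by (blast dest: in_arcsD2)+
    then show "(p \<circ> f) u \<noteq> (p \<circ> f) w"
      using assms(3) by (auto dest: inj_onD)
  qed
qed

text \<open>The color \<open>Suc k\<close> occurs nowhere else, so \<open>v\<close> cannot clash
  with any vertex. Once the color of the root is unique, it can be renamed independently of the
  colors of all other vertices.\<close>

lemma injective_coloring_recolor_new:
  assumes "pair_graph G" and f: "injective_coloring G k f"
  shows "injective_coloring G (Suc k) (f(v := Suc k))"
proof -
  interpret pair_graph G by fact
  have f_le: "f u \<in> {1..k}" if "u \<in> pverts G" for u
    using f that unfolding injective_coloring_def by blast
  show ?thesis
    unfolding injective_coloring_def
  proof (intro conjI ballI allI impI)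
    show "(f(v := Suc k)) ` pverts G \<subseteq> {1..Suc k}"
      using f_le by (auto simp: le_Suc_eq)
    fix x u w
    assume x: "x \<in> pverts G" and uw: "(x, u) \<in> parcs G \<and> (x, w) \<in> parcs G \<and> u \<noteq> w"
    then have "u \<in> pverts G" "w \<in> pverts G" by (blast dest: in_arcsD2)+
    then have "f u \<noteq> Suc k" "f w \<noteq> Suc k" using f_le by force+
    moreover have "f u \<noteq> f w" using injective_coloringD[OF f x] uw by blast
    ultimately show "(f(v := Suc k)) u \<noteq> (f(v := Suc k)) w"
      using uw by auto
  qed
qed

text \<open>Map \<open>A\<close> onto a subset of \<open>B\<close> of the same size; the two
  complements are then equinumerous and can be matched separately.\<close>

lemma ex_bij_betw_image_subset:
  assumes "finite S" and "finite T" and "card S = card T"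
    and "A \<subseteq> S" and "B \<subseteq> T" and "card A \<le> card B"
  obtains p where "bij_betw p S T" and "p ` A \<subseteq> B"
proof -
  have fin: "finite A" "finite B" using assms finite_subset by blast+
  obtain B' where B': "B' \<subseteq> B" "card B' = card A"
    using obtain_subset_with_card_n[OF assms(6)] by metis
  have finB': "finite B'" using B' fin finite_subset by blast
  obtain q where q: "bij_betw q A B'"
    using finite_same_card_bij[OF fin(1) finB'] B' by metis
  have "card (S - A) = card (T - B')"
    using assms B' fin finB' by (simp add: card_Diff_subset order_trans[of B' B T])
  then obtain r where r: "bij_betw r (S - A) (T - B')"
    using finite_same_card_bij[of "S - A" "T - B'"] assms by auto
  let ?p = "\<lambda>x. if x \<in> A then q x else r x"
  have "bij_betw ?p A B'"
    using q by (simp cong: bij_betw_cong)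
  moreover have "bij_betw ?p (S - A) (T - B')"
    using r by (rule bij_betw_cong[THEN iffD1, rotated]) simp
  ultimately have "bij_betw ?p (A \<union> (S - A)) (B' \<union> (T - B'))"
    by (rule bij_betw_combine) auto
  moreover have "A \<union> (S - A) = S" "B' \<union> (T - B') = T" using assms B' by auto
  moreover have "?p ` A \<subseteq> B" using q B' by (auto simp: bij_betw_def)
  ultimately show thesis using that by metis
qed

text \<open>Recolor \<open>v\<close> with \<open>Suc k\<close>, then apply a permutation of
  \<open>{1..Suc k}\<close> that sends \<open>Suc k\<close> to \<open>a\<close> and the old colors
  of the neighbours of \<open>v\<close> outside \<open>D\<close>.\<close>

lemma injective_coloring_prescribed_root:
  assumes "pair_graph H" and "v \<in> pverts H" and f: "injective_coloring H k f"
    and a: "a \<in> {1..Suc k}" and D: "finite D" "card D + degree H v \<le> k"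
  obtains h where "injective_coloring H (Suc k) h" and "h v = a"
    and "\<And>u. (v, u) \<in> parcs H \<Longrightarrow> h u \<notin> D"
proof -
  interpret pair_graph H by fact
  let ?N = "{u. (v, u) \<in> parcs H}"
  have vN: "v \<notin> ?N" using no_loops' by auto
  have N: "?N \<subseteq> pverts H" by (auto dest: in_arcsD2)
  have fN: "f ` ?N \<subseteq> {1..k}" using f N unfolding injective_coloring_def by blast
  \<comment> \<open>Exactly \<open>k\<close> colors differ from \<open>a\<close>. At least
    \<open>k - card D\<close> of them avoid \<open>D\<close>, with inequality because
    \<open>D\<close> may contain \<open>a\<close> or numbers that are not colors.\<close>
  have "card (f ` ?N) \<le> k - card D"
    using card_image_le[OF finite_neighbours, of f v] D(2) by (simp add: degree_eq_card)
  also have "\<dots> = card ({1..Suc k} - {a}) - card D" using a by simp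
  also have "\<dots> \<le> card ({1..Suc k} - {a} - D)" by (rule diff_card_le_card_Diff[OF D(1)])
  finally have "card (f ` ?N) \<le> card ({1..Suc k} - {a} - D)" .
  moreover have "card {1..k} = card ({1..Suc k} - {a})" using a by simp
  ultimately obtain p where p: "bij_betw p {1..k} ({1..Suc k} - {a})"
    "p ` (f ` ?N) \<subseteq> {1..Suc k} - {a} - D"
    using ex_bij_betw_image_subset[of "{1..k}" "{1..Suc k} - {a}" "f ` ?N" "{1..Suc k} - {a} - D"]
      fN by auto
  \<comment> \<open>Sending the extra color \<open>Suc k\<close> to the omitted value
    \<open>a\<close> extends \<open>p\<close> to a permutation of \<open>{1..Suc k}\<close>.\<close>
  let ?p = "p(Suc k := a)"
  have "bij_betw ?p {1..k} ({1..Suc k} - {a})"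
    using p(1) by (rule bij_betw_cong[THEN iffD1, rotated]) auto
  moreover have "bij_betw ?p {Suc k} {a}" by (simp add: bij_betw_def)
  ultimately have "bij_betw ?p ({1..k} \<union> {Suc k}) ({1..Suc k} - {a} \<union> {a})"
    by (rule bij_betw_combine) auto
  moreover have "{1..k} \<union> {Suc k} = {1..Suc k}" "{1..Suc k} - {a} \<union> {a} = {1..Suc k}"
    using a by auto
  ultimately have ip: "inj_on ?p {1..Suc k}" "?p ` {1..Suc k} \<subseteq> {1..Suc k}"
    by (simp_all only: bij_betw_def order_refl)
  let ?h = "?p \<circ> f(v := Suc k)"
  show thesis
  proof (rule that)
    show "injective_coloring H (Suc k) ?h"
      using injective_coloring_comp[OF assms(1) injective_coloring_recolor_new[OF assms(1) f] ip] .
    show "?h v = a" by simp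
    show "?h u \<notin> D" if "(v, u) \<in> parcs H" for u
    proof -
      \<comment> \<open>A neighbour of the root is not the root, so it keeps its old color, which is
        at most \<open>k\<close> and hence renamed by \<open>p\<close> itself.\<close>
      have "u \<noteq> v" "f u \<in> {1..k}" "p (f u) \<notin> D" using that vN fN p(2) by auto
      then show ?thesis by auto
    qed
  qed
qed

section \<open>Neighbourhoods and restricted colorings in the rooted product\<close>

lemma parcs_rooted_product_iff:
  "((g, h), (g', h')) \<in> parcs (rooted_product G H v) \<longleftrightarrow>
     g = g' \<and> g \<in> pverts G \<and> (h, h') \<in> parcs H \<or> h = v \<and> h' = v \<and> (g, g') \<in> parcs G"
  by (auto simp: rooted_product_def)

lemma pverts_rooted_product: "pverts (rooted_product G H v) = pverts G \<times> pverts H"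
  by (simp add: rooted_product_def)

text \<open>The neighbours of \<open>(g, v)\<close> in the copy of \<open>G\<close> and those in the
  copy of \<open>H\<close> at \<open>g\<close> are disjoint: a common one would give a loop of
  \<open>G\<close> at \<open>g\<close>.\<close>

lemma degree_rooted_product_root:
  assumes "pair_graph G" and "pair_graph H" and "g \<in> pverts G"
  shows "degree (rooted_product G H v) (g, v) = degree G g + degree H v"
proof -
  interpret G: pair_graph G by fact
  interpret H: pair_graph H by fact
  have "{w. ((g, v), w) \<in> parcs (rooted_product G H v)} =
      (\<lambda>g'. (g', v)) ` {g'. (g, g') \<in> parcs G} \<union> Pair g ` {h. (v, h) \<in> parcs H}"
    using assms(3) by (auto simp: parcs_rooted_product_iff)
  moreover have "(\<lambda>g'. (g', v)) ` {g'. (g, g') \<in> parcs G} \<inter> Pair g ` {h. (v, h) \<in> parcs H} = {}"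
    using G.no_loops' by auto
  ultimately show ?thesis
    by (simp add: degree_eq_card card_Un_disjoint G.finite_neighbours H.finite_neighbours
        card_image inj_on_def)
qed

lemma injective_coloring_rooted_product_base:
  assumes "injective_coloring (rooted_product G H v) k f" and "v \<in> pverts H"
  shows "injective_coloring G k (\<lambda>g. f (g, v))"
  unfolding injective_coloring_def
proof (intro conjI ballI allI impI)
  show "(\<lambda>g. f (g, v)) ` pverts G \<subseteq> {1..k}"
    using assms unfolding injective_coloring_def pverts_rooted_product by blast
  show "f (u, v) \<noteq> f (w, v)"
    if "x \<in> pverts G" "(x, u) \<in> parcs G \<and> (x, w) \<in> parcs G \<and> u \<noteq> w" for x u w
    using injective_coloringD[OF assms(1), of "(x, v)" "(u, v)" "(w, v)"] that assms(2)
    by (auto simp: parcs_rooted_product_iff pverts_rooted_product)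
qed

lemma injective_coloring_rooted_product_fibre:
  assumes "injective_coloring (rooted_product G H v) k f" and "g \<in> pverts G"
  shows "injective_coloring H k (\<lambda>h. f (g, h))"
  unfolding injective_coloring_def
proof (intro conjI ballI allI impI)
  show "(\<lambda>h. f (g, h)) ` pverts H \<subseteq> {1..k}"
    using assms unfolding injective_coloring_def pverts_rooted_product by blast
  show "f (g, u) \<noteq> f (g, w)"
    if "x \<in> pverts H" "(x, u) \<in> parcs H \<and> (x, w) \<in> parcs H \<and> u \<noteq> w" for x u w
    using injective_coloringD[OF assms(1), of "(g, x)" "(g, u)" "(g, w)"] that assms(2)
    by (auto simp: parcs_rooted_product_iff pverts_rooted_product)
qed

section \<open>Lower and upper bounds for the rooted product\<close>

lemma injective_chromatic_number_rooted_product_ge: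
  assumes "pair_graph G" and "pair_graph H" and "v \<in> pverts H" and "pverts G \<noteq> {}"
  shows "max (max (injective_chromatic_number G) (injective_chromatic_number H))
      (max_degree G + degree H v) \<le> injective_chromatic_number (rooted_product G H v)"
proof -
  note P = pair_graph_rooted_product[OF assms(1-3)]
  obtain f where f: "injective_coloring (rooted_product G H v)
      (injective_chromatic_number (rooted_product G H v)) f"
    using injective_coloring_if_chromatic_number_le[OF P order_refl] .
  \<comment> \<open>Here \<open>G\<close> must be nonempty: \<open>g\<close> provides a vertex of
    maximum degree and also a copy of \<open>H\<close> inside the product.\<close>
  obtain g where g: "g \<in> pverts G" "max_degree G = degree G g"
    using pair_graph.max_degree_attained[OF assms(1,4)] .
  have "(g, v) \<in> pverts (rooted_product G H v)"
    using g(1) assms(3) by (simp add: pverts_rooted_product)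
  then have "max_degree G + degree H v \<le> injective_chromatic_number (rooted_product G H v)"
    using degree_le_injective_coloring[OF P f] degree_rooted_product_root[OF assms(1,2) g(1)] g(2)
    by metis
  then show ?thesis
    using injective_chromatic_number_le[OF injective_coloring_rooted_product_base[OF f assms(3)]]
      injective_chromatic_number_le[OF injective_coloring_rooted_product_fibre[OF f g(1)]]
    by simp
qed

lemma injective_chromatic_number_rooted_product_le:
  assumes "pair_graph G" and "pair_graph H" and v: "v \<in> pverts H"
    and "injective_chromatic_number G \<le> k" and "injective_chromatic_number H \<le> k"
    and k: "max_degree G + degree H v \<le> k"
  shows "injective_chromatic_number (rooted_product G H v) \<le> Suc k"
proof -
  interpret G: pair_graph G by fact
  interpret H: pair_graph H by fact
  obtain c where c: "injective_coloring G k c"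
    using injective_coloring_if_chromatic_number_le[OF assms(1,4)] .
  obtain f where f: "injective_coloring H k f"
    using injective_coloring_if_chromatic_number_le[OF assms(2,5)] .
  have "\<exists>h. injective_coloring H (Suc k) h \<and> h v = c g \<and>
      (\<forall>u g'. (v, u) \<in> parcs H \<and> (g, g') \<in> parcs G \<longrightarrow> h u \<noteq> c g')"
    if g: "g \<in> pverts G" for g
  proof -
    \<comment> \<open>The roots adjacent to \<open>(g, v)\<close> will carry the colors in
      \<open>?D\<close>, so the neighbours of the root inside the copy at \<open>g\<close> have to
      avoid them.\<close>
    let ?D = "c ` {g'. (g, g') \<in> parcs G}"
    have "card ?D \<le> degree G g"
      using card_image_le[OF G.finite_neighbours] by (simp add: degree_eq_card)
    then have D: "card ?D + degree H v \<le> k"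
      using G.degree_le_max_degree[OF g] k by linarith
    have a: "c g \<in> {1..Suc k}"
      using c g unfolding injective_coloring_def by force
    obtain h where "injective_coloring H (Suc k) h" "h v = c g"
      "\<And>u. (v, u) \<in> parcs H \<Longrightarrow> h u \<notin> ?D"
      using injective_coloring_prescribed_root[OF assms(2) v f a _ D] G.finite_neighbours
      by blast
    then show ?thesis by blast
  qed
  then obtain h where h: "\<And>g. g \<in> pverts G \<Longrightarrow> injective_coloring H (Suc k) (h g)"
    and hv: "\<And>g. g \<in> pverts G \<Longrightarrow> h g v = c g"
    and hN: "\<And>g u g'. g \<in> pverts G \<Longrightarrow> (v, u) \<in> parcs H \<Longrightarrow> (g, g') \<in> parcs G \<Longrightarrow> h g u \<noteq> c g'"
    by metis
  have "injective_coloring (rooted_product G H v) (Suc k) (\<lambda>(g, x). h g x)"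
    unfolding injective_coloring_def
  proof (intro conjI ballI allI impI)
    show "(\<lambda>(g, x). h g x) ` pverts (rooted_product G H v) \<subseteq> {1..Suc k}"
      using h unfolding injective_coloring_def pverts_rooted_product by fast
    fix x u w
    assume "x \<in> pverts (rooted_product G H v)"
      and A: "(x, u) \<in> parcs (rooted_product G H v) \<and> (x, w) \<in> parcs (rooted_product G H v) \<and> u \<noteq> w"
    moreover obtain g a g1 a1 g2 a2 where x: "x = (g, a)" "u = (g1, a1)" "w = (g2, a2)"
      by (metis surj_pair)
    ultimately have g: "g \<in> pverts G" and a: "a \<in> pverts H"
      by (simp_all add: pverts_rooted_product)
    have arcs: "g = g1 \<and> (a, a1) \<in> parcs H \<or> a = v \<and> a1 = v \<and> (g, g1) \<in> parcs G"
      "g = g2 \<and> (a, a2) \<in> parcs H \<or> a = v \<and> a2 = v \<and> (g, g2) \<in> parcs G"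
      using A x by (auto simp: parcs_rooted_product_iff)
    have "h g1 a1 \<noteq> h g2 a2"
    proof
      assume eq: "h g1 a1 = h g2 a2"
      \<comment> \<open>The two neighbours of \<open>x\<close> lie both in one copy of
        \<open>H\<close>, both in the copy of \<open>G\<close>, or one in each; the mixed cases
        force \<open>x\<close> to be a root.\<close>
      consider (fibre) "g = g1" "(a, a1) \<in> parcs H" "g = g2" "(a, a2) \<in> parcs H"
        | (base) "a1 = v" "(g, g1) \<in> parcs G" "a2 = v" "(g, g2) \<in> parcs G"
        | (left) "g = g1" "(v, a1) \<in> parcs H" "a2 = v" "(g, g2) \<in> parcs G"
        | (right) "g = g2" "(v, a2) \<in> parcs H" "a1 = v" "(g, g1) \<in> parcs G"
        using arcs by blast
      then show False
      proof cases
        case fibre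
        then have "a1 = a2" using injective_coloringD[OF h[OF g] a] eq by blast
        then show False using fibre A x by simp
      next
        case base
        \<comment> \<open>Both neighbours are roots, and the root of each copy is colored by
          \<open>c\<close>.\<close>
        then have "c g1 = c g2" using eq hv G.in_arcsD2 by metis
        then have "g1 = g2" using injective_coloringD[OF c g] base by blast
        then show False using base A x by simp
      next
        case left
        \<comment> \<open>The root \<open>(g2, v)\<close> has color \<open>c g2\<close>, which the
          neighbours of the root in the copy at \<open>g\<close> avoid.\<close>
        then show False using eq hv hN[OF g] G.in_arcsD2 by metis
      next
        case right
        then show False using eq hv hN[OF g] G.in_arcsD2 by metis
      qed
    qed
    then show "(\<lambda>(g, x). h g x) u \<noteq> (\<lambda>(g, x). h g x) w" using x by simp
  qed
  then show ?thesis by (rule injective_chromatic_number_le)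
qed

theorem theorem4p6:
  fixes G :: "'a pair_pre_digraph" and H :: "'b pair_pre_digraph" and v :: 'b
  assumes "pair_graph G" and "pair_graph H" and "v \<in> pverts H"
  shows "injective_chromatic_number (rooted_product G H v) \<in>
    {injective_chromatic_number G, injective_chromatic_number H,
     injective_chromatic_number G + 1, injective_chromatic_number H + 1,
     max_degree G + degree H v, max_degree G + degree H v + 1}"
proof (cases "pverts G = {}")
  case True
  have "injective_coloring G 0 f" "injective_coloring (rooted_product G H v) 0 f'" for f f'
    using True by (simp_all add: injective_coloring_def pverts_rooted_product)
  then have "injective_chromatic_number G = 0"
    "injective_chromatic_number (rooted_product G H v) = 0"
    using injective_chromatic_number_le by fastforce+
  then show ?thesis by simp
next
  case False
  let ?M = "max (max (injective_chromatic_number G) (injective_chromatic_number H))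
      (max_degree G + degree H v)"
  have "?M \<le> injective_chromatic_number (rooted_product G H v)"
    using injective_chromatic_number_rooted_product_ge[OF assms False] .
  moreover have "injective_chromatic_number (rooted_product G H v) \<le> Suc ?M"
    by (rule injective_chromatic_number_rooted_product_le[OF assms]) simp_all
  ultimately have "injective_chromatic_number (rooted_product G H v) \<in> {?M, ?M + 1}"
    by auto
  \<comment> \<open>The maximum \<open>?M\<close> equals one of its three arguments, which yields
    the six listed values.\<close>
  then show ?thesis
    unfolding max_def by (elim insertE emptyE) (simp_all split: if_splits)
qed

end
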